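(* Let $H$ be a group acting freely on a nonempty median set $\mathbb{X}=(X,m)$. Then there exists a group $\widehat{H}$ acting freely on a median set $\widehat{\mathbb{X}}=(\widehat{X},\widehat{m})$, together with an injective group morphism $\iota_0:H\to\widehat{H}$ and an $H$-equivariant embedding of median sets $\iota:\mathbb{X}\to\widehat{\mathbb{X}}$ (i.e. an injective morphism of median sets with $\iota(h\cdot x)=\iota_0(h)\cdot\iota(x)$) such that $\iota(X)\subseteq\widehat{H}\,\iota(x)$ for some (equivalently, for all) $x\in X$, and the following universal property is satisfied. (RTUP) For every group $\widetilde{H}$ acting freely on a median set $\widetilde{\mathbb{X}}=(\widetilde{X},\widetilde{m})$ and for every morphism $(\psi_0,\psi):(H,\mathbb{X})\to(\widetilde{H},\widetilde{\mathbb{X}})$ in FAMS such that $\psi(X)\subseteq\widetilde{H}\,\psi(x)$ for some (equivalently, for all) $x\in X$, there exists a unique morphism $(\widehat{\psi}_0,\widehat{\psi}):(\widehat{H},\widehat{\mathbb{X}})\to(\widetilde{H},\widetilde{\mathbb{X}})$ in FAMS such that $\widehat{\psi}_0\circ\iota_0=\psi_0$ and $\widehat{\psi}\circ\iota=\psi$.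
   Context: A median set is a set $X$ with a map $m:X^3\to X$ such that (M1) $m(x,y,z)=m(y,x,z)=m(x,z,y)$; (M2) $m(x,y,x)=x$; (M3) $m(m(x,y,z),u,v)=m(m(x,u,v),m(y,u,v),z)$. Morphisms of median sets are the maps preserving $m$. An action (from the left) of a group $G$ on a median set $(X,m)$ is an action on the set $X$ with $g\cdot m(x,y,z)=m(g\cdot x,g\cdot y,g\cdot z)$; it is free if $g\cdot x=x$ for some $x\in X$ implies $g=1$. FAMS is the category whose objects are pairs $(G,\mathbb{X})$ with $G$ a group acting freely on a nonempty median set $\mathbb{X}$, and whose morphisms $(G,\mathbb{X})\to(G',\mathbb{X}')$ are pairs $(\psi_0,\psi)$ with $\psi_0:G\to G'$ a group morphism and $\psi:\mathbb{X}\to\mathbb{X}'$ a morphism of median sets such that $\psi(g\cdot x)=\psi_0(g)\cdot\psi(x)$ for all $g\in G$, $x\in X$. *)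

theory Defs
  imports "HOL-Algebra.Group_Action"
begin

section \<open>Median sets and their morphisms\<close>

locale median_set =
  fixes X :: "'x set" and m :: "'x \<Rightarrow> 'x \<Rightarrow> 'x \<Rightarrow> 'x"
  assumes median_closed: "\<lbrakk>x \<in> X; y \<in> X; z \<in> X\<rbrakk> \<Longrightarrow> m x y z \<in> X"
    and median_swap12: "\<lbrakk>x \<in> X; y \<in> X; z \<in> X\<rbrakk> \<Longrightarrow> m x y z = m y x z"
    and median_swap23: "\<lbrakk>x \<in> X; y \<in> X; z \<in> X\<rbrakk> \<Longrightarrow> m x y z = m x z y"
    and median_absorb: "\<lbrakk>x \<in> X; y \<in> X\<rbrakk> \<Longrightarrow> m x y x = x"
    and median_distrib:
      "\<lbrakk>x \<in> X; y \<in> X; z \<in> X; u \<in> X; v \<in> X\<rbrakk>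
        \<Longrightarrow> m (m x y z) u v = m (m x u v) (m y u v) z"

definition median_hom ::
    "'x set \<Rightarrow> ('x \<Rightarrow> 'x \<Rightarrow> 'x \<Rightarrow> 'x) \<Rightarrow> 'y set \<Rightarrow> ('y \<Rightarrow> 'y \<Rightarrow> 'y \<Rightarrow> 'y) \<Rightarrow> ('x \<Rightarrow> 'y) set" where
  "median_hom X m Y n =
    {f \<in> X \<rightarrow> Y. \<forall>x\<in>X. \<forall>y\<in>X. \<forall>z\<in>X. f (m x y z) = n (f x) (f y) (f z)}"

section \<open>The category FAMS of free actions on nonempty median sets\<close>

record ('g, 'x) fams =
  grp :: "'g monoid"
  pts :: "'x set"
  med :: "'x \<Rightarrow> 'x \<Rightarrow> 'x \<Rightarrow> 'x"
  act :: "'g \<Rightarrow> 'x \<Rightarrow> 'x"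

definition fams_obj :: "('g, 'x) fams \<Rightarrow> bool" where
  "fams_obj A \<longleftrightarrow>
    group_action (grp A) (pts A) (act A) \<and>
    median_set (pts A) (med A) \<and>
    pts A \<noteq> {} \<and>
    (\<forall>g\<in>carrier (grp A). \<forall>x\<in>pts A. \<forall>y\<in>pts A. \<forall>z\<in>pts A.
      act A g (med A x y z) = med A (act A g x) (act A g y) (act A g z)) \<and>
    (\<forall>g\<in>carrier (grp A). (\<exists>x\<in>pts A. act A g x = x) \<longrightarrow> g = \<one>\<^bsub>grp A\<^esub>)"

definition fams_hom ::
    "('g, 'x) fams \<Rightarrow> ('h, 'y) fams \<Rightarrow> (('g \<Rightarrow> 'h) \<times> ('x \<Rightarrow> 'y)) set" where
  "fams_hom A B =
    {(f0, f). f0 \<in> hom (grp A) (grp B) \<and>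
              f \<in> median_hom (pts A) (med A) (pts B) (med B) \<and>
              (\<forall>g\<in>carrier (grp A). \<forall>x\<in>pts A. f (act A g x) = act B (f0 g) (f x))}"

definition image_in_one_orbit ::
    "('g, 'x) fams \<Rightarrow> ('h, 'y) fams \<Rightarrow> ('x \<Rightarrow> 'y) \<Rightarrow> bool" where
  "image_in_one_orbit A B f \<longleftrightarrow> (\<exists>x\<in>pts A. f ` pts A \<subseteq> orbit (grp B) (act B) (f x))"

lemma image_in_one_orbit_iff_all:
  assumes "fams_obj A" "fams_obj B" "(f0, f) \<in> fams_hom A B"
  shows "image_in_one_orbit A B f \<longleftrightarrow>
    (\<forall>x\<in>pts A. f ` pts A \<subseteq> orbit (grp B) (act B) (f x))"
proof -
  interpret group_action "grp B" "pts B" "act B"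
    using assms(2) by (simp add: fams_obj_def)
  have ne: "pts A \<noteq> {}" and img: "\<And>x. x \<in> pts A \<Longrightarrow> f x \<in> pts B"
    using assms by (auto simp: fams_obj_def fams_hom_def median_hom_def)
  have "f z \<in> orbit (grp B) (act B) (f y)"
    if "x \<in> pts A" "f ` pts A \<subseteq> orbit (grp B) (act B) (f x)" "y \<in> pts A" "z \<in> pts A" for x y z
    using that img orbit_sym[of "f x" "f y"] orbit_trans[of "f y" "f x" "f z"] by blast
  then show ?thesis
    unfolding image_in_one_orbit_def using ne by blast
qed

section \<open>Relatively transitive embeddings and their universal property\<close>

definition rt_embedding ::
    "('h, 'x) fams \<Rightarrow> ('g, 'y) fams \<Rightarrow> ('h \<Rightarrow> 'g) \<Rightarrow> ('x \<Rightarrow> 'y) \<Rightarrow> bool" where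
  "rt_embedding A B \<iota>0 \<iota> \<longleftrightarrow>
    fams_obj B \<and> (\<iota>0, \<iota>) \<in> fams_hom A B \<and>
    inj_on \<iota>0 (carrier (grp A)) \<and> inj_on \<iota> (pts A) \<and>
    image_in_one_orbit A B \<iota>"

text \<open>
  The property RTUP tested against a single object \<open>C\<close>. Two morphisms out of \<open>B\<close> are equal
  iff they agree on the carriers of \<open>B\<close>; restricting to extensional functions expresses this
  by equality of HOL functions, so that unique existence has its intended meaning.
\<close>

definition rtup_at ::
    "('h, 'x) fams \<Rightarrow> ('g, 'y) fams \<Rightarrow> ('h \<Rightarrow> 'g) \<Rightarrow> ('x \<Rightarrow> 'y) \<Rightarrow> ('k, 'z) fams \<Rightarrow> bool" where
  "rtup_at A B \<iota>0 \<iota> C \<longleftrightarrow>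
    (\<forall>\<psi>0 \<psi>. (\<psi>0, \<psi>) \<in> fams_hom A C \<and> image_in_one_orbit A C \<psi> \<longrightarrow>
      (\<exists>!(\<phi>0, \<phi>). (\<phi>0, \<phi>) \<in> fams_hom B C \<and>
                  \<phi>0 \<in> extensional (carrier (grp B)) \<and> \<phi> \<in> extensional (pts B) \<and>
                  (\<forall>h\<in>carrier (grp A). \<phi>0 (\<iota>0 h) = \<psi>0 h) \<and>
                  (\<forall>x\<in>pts A. \<phi> (\<iota> x) = \<psi> x)))"

text \<open>
  The object \<open>B\<close> is asserted to exist before the test object \<open>C\<close> is quantified, but HOL has no
  quantifier over types inside a formula. Existence and the universal property are therefore
  stated in one fixed universe, built from the types of the given action, which is
  infinite and at least as large as the given group and median set. That the universal property
  then holds against test objects over arbitrary types is a claim about the same \<open>B\<close>,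
  with the types of \<open>C\<close> as free type variables of the theorem.
\<close>

type_synonym ('h, 'x) univ = "('h + 'x) list"
type_synonym ('h, 'x) ufams = "(('h, 'x) univ, ('h, 'x) univ) fams"

definition rt_universal ::
    "('h, 'x) fams \<Rightarrow> ('h, 'x) ufams \<Rightarrow> ('h \<Rightarrow> ('h, 'x) univ) \<Rightarrow> ('x \<Rightarrow> ('h, 'x) univ) \<Rightarrow> bool" where
  "rt_universal A B \<iota>0 \<iota> \<longleftrightarrow>
    rt_embedding A B \<iota>0 \<iota> \<and>
    (\<forall>C :: ('h, 'x) ufams. fams_obj C \<longrightarrow> rtup_at A B \<iota>0 \<iota> C)"

end

theory Submission
  imports Defs
begin

text \<open>
  The objects considered here are two-sorted algebras: a group, a median set and an action,
  together with elements named by \<open>A\<close>. The requirements on them -- group axioms, median axioms,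
  action axioms, compatibility with \<open>A\<close>, and freeness in the form ``if \<open>s \<cdot> p = p\<close> then
  \<open>s = \<one>\<close>'' -- are Horn clauses. Fix a point \<open>base\<close> of \<open>A\<close>. That the image of \<open>A\<close> lies in
  one orbit means that there is, for each point \<open>x\<close>, a group element carrying \<open>base\<close> to \<open>x\<close>; it
  is unique because the action is free, so it may be named by a constant. Hence the universal
  object is the initial model of a Horn theory: terms modulo the congruence that the clauses
  generate (\<open>geq\<close>, \<open>peq\<close>). Its terms evaluate in every object over any types
  (\<open>eval_sound\<close>), which gives existence in the universal property, and uniqueness holds because
  every element is the class of a term (\<open>extension_unique\<close>). Terms over \<open>'h + 'x\<close> can be coded
  by lists over \<open>'h + 'x\<close>, so the quotient fits into the universe \<open>('h, 'x) univ\<close>.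

  What is not formal is that \<open>A\<close> embeds into this quotient. Two points of \<open>A\<close> are kept apart as
  soon as a single relatively transitive embedding of \<open>A\<close> into any object exists
  (\<open>tree_rt_embedding\<close>). Such an object is a tree of copies of the median set of \<open>A\<close>: through
  each point passes one copy for every orbit of the group \<open>H\<close> of \<open>A\<close>, and otherwise the copies are
  as disjoint as possible. Its points are the reduced words of the universal group of a groupoid, namely
  the one whose arrows are the \<open>H\<close>-orbits of pairs of points of \<open>A\<close>; the words form a group
  acting simply transitively on itself by left multiplication. Every copy carries a
  projection of the whole tree onto it, and the median of three words is the word whose
  projection to every copy is the median of the three projections. All median axioms are
  inherited from \<open>A\<close> coordinate by coordinate; the point to prove is that the word exists
  (\<open>centre_ex\<close>).

  The tree itself is in general not universal: along a branch it forces betweenness relations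
  that fail in other objects. For \<open>H\<close> trivial acting on two points, the tree is the line of
  integers, while the group of order two swapping the two points is an admissible target, and no
  median preserving equivariant map from the line to it extends the identity of the two points.

  Finally, two objects with the universal property with respect to each other are isomorphic
  under \<open>A\<close>. Any universal object in the fixed universe is therefore isomorphic to the
  term quotient and inherits its universal property over arbitrary types
  (\<open>rtup_at_transfer\<close>).
\<close>

section \<open>Free actions on median sets\<close>

text \<open>
  Group actions take values in extensional bijections, hence the restriction.
\<close>

lemma group_action_restrictI:
  assumes "group G"
    and closed: "\<And>g x. \<lbrakk>g \<in> carrier G; x \<in> E\<rbrakk> \<Longrightarrow> a g x \<in> E"
    and one: "\<And>x. x \<in> E \<Longrightarrow> a \<one>\<^bsub>G\<^esub> x = x"
    and mult: "\<And>g h x. \<lbrakk>g \<in> carrier G; h \<in> carrier G; x \<in> E\<rbrakk> \<Longrightarrow> a (g \<otimes>\<^bsub>G\<^esub> h) x = a g (a h x)"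
  shows "group_action G E (\<lambda>g. restrict (a g) E)"
proof -
  interpret group G by fact
  have "bij_betw (a g) E E" if g: "g \<in> carrier G" for g
  proof (rule bij_betw_byWitness[where f' = "a (inv\<^bsub>G\<^esub> g)"])
    have ig: "inv\<^bsub>G\<^esub> g \<in> carrier G" using g by simp
    show "\<forall>x\<in>E. a (inv\<^bsub>G\<^esub> g) (a g x) = x"
      using mult[OF ig g] g one by (auto simp flip: mult[OF ig g])
    show "\<forall>x\<in>E. a g (a (inv\<^bsub>G\<^esub> g) x) = x"
      using g one by (auto simp flip: mult[OF g ig])
    show "a g ` E \<subseteq> E" "a (inv\<^bsub>G\<^esub> g) ` E \<subseteq> E"
      using closed g ig by auto
  qed
  then have bij: "restrict (a g) E \<in> Bij E" if "g \<in> carrier G" for g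
    using that by (auto simp: Bij_def cong: bij_betw_cong)
  show ?thesis
    unfolding group_action_def group_hom_def group_hom_axioms_def
  proof (intro conjI \<open>group G\<close> group_BijGroup homI)
    fix g assume "g \<in> carrier G"
    then show "restrict (a g) E \<in> carrier (BijGroup E)" using bij by (simp add: BijGroup_def)
  next
    fix g h assume gh: "g \<in> carrier G" "h \<in> carrier G"
    then show "restrict (a (g \<otimes>\<^bsub>G\<^esub> h)) E
        = restrict (a g) E \<otimes>\<^bsub>BijGroup E\<^esub> restrict (a h) E"
      using bij closed by (auto simp: BijGroup_def compose_def mult fun_eq_iff)
  qed
qed

lemma fams_homD:
  assumes "(f0, f) \<in> fams_hom A B"
  shows "f0 \<in> hom (grp A) (grp B)" "\<And>x. x \<in> pts A \<Longrightarrow> f x \<in> pts B"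
    "\<And>g. g \<in> carrier (grp A) \<Longrightarrow> f0 g \<in> carrier (grp B)"
    "\<And>x y z. \<lbrakk>x \<in> pts A; y \<in> pts A; z \<in> pts A\<rbrakk> \<Longrightarrow> f (med A x y z) = med B (f x) (f y) (f z)"
    "\<And>g x. \<lbrakk>g \<in> carrier (grp A); x \<in> pts A\<rbrakk> \<Longrightarrow> f (act A g x) = act B (f0 g) (f x)"
    "\<And>g h. \<lbrakk>g \<in> carrier (grp A); h \<in> carrier (grp A)\<rbrakk>
      \<Longrightarrow> f0 (g \<otimes>\<^bsub>grp A\<^esub> h) = f0 g \<otimes>\<^bsub>grp B\<^esub> f0 h"
  using assms by (auto simp: fams_hom_def median_hom_def hom_def)

locale fams_object =
  fixes A :: "('h, 'x) fams"
  assumes fams_obj: "fams_obj A"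
begin

abbreviation H where "H \<equiv> carrier (grp A)"
abbreviation X where "X \<equiv> pts A"
abbreviation dot (infixr "\<cdot>" 75) where "h \<cdot> x \<equiv> act A h x"

sublocale action: group_action "grp A" "pts A" "act A"
  using fams_obj by (simp add: fams_obj_def)

sublocale group "grp A"
  using action.group_hom group_hom.axioms(1) by blast

sublocale median_set "pts A" "med A"
  using fams_obj by (simp add: fams_obj_def)

lemma pts_nonempty: "X \<noteq> {}"
  using fams_obj by (simp add: fams_obj_def)

lemma act_closed [simp]: "\<lbrakk>h \<in> H; x \<in> X\<rbrakk> \<Longrightarrow> h \<cdot> x \<in> X"
  by (rule action.element_image) auto

lemma act_one [simp]: "x \<in> X \<Longrightarrow> \<one>\<^bsub>grp A\<^esub> \<cdot> x = x"
  using action.id_eq_one by (metis restrict_apply')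

lemma act_mult: "\<lbrakk>h \<in> H; k \<in> H; x \<in> X\<rbrakk> \<Longrightarrow> (h \<otimes>\<^bsub>grp A\<^esub> k) \<cdot> x = h \<cdot> k \<cdot> x"
  by (rule action.composition_rule)

lemma act_inv [simp]:
  "\<lbrakk>h \<in> H; x \<in> X\<rbrakk> \<Longrightarrow> inv\<^bsub>grp A\<^esub> h \<cdot> h \<cdot> x = x"
  "\<lbrakk>h \<in> H; x \<in> X\<rbrakk> \<Longrightarrow> h \<cdot> inv\<^bsub>grp A\<^esub> h \<cdot> x = x"
  by (simp_all flip: act_mult)

lemma act_left_cancel: "\<lbrakk>h \<in> H; x \<in> X; y \<in> X\<rbrakk> \<Longrightarrow> h \<cdot> x = h \<cdot> y \<longleftrightarrow> x = y"
  by (metis act_inv(1))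

lemma act_med:
  "\<lbrakk>h \<in> H; x \<in> X; y \<in> X; z \<in> X\<rbrakk> \<Longrightarrow> h \<cdot> med A x y z = med A (h \<cdot> x) (h \<cdot> y) (h \<cdot> z)"
  using fams_obj by (simp add: fams_obj_def)

lemma act_free: "\<lbrakk>h \<in> H; x \<in> X; h \<cdot> x = x\<rbrakk> \<Longrightarrow> h = \<one>\<^bsub>grp A\<^esub>"
  using fams_obj by (auto simp: fams_obj_def)

lemma act_right_cancel: "\<lbrakk>h \<in> H; k \<in> H; x \<in> X; h \<cdot> x = k \<cdot> x\<rbrakk> \<Longrightarrow> h = k"
  using act_free[of "inv\<^bsub>grp A\<^esub> k \<otimes>\<^bsub>grp A\<^esub> h" x]
  by (metis act_inv(1) act_mult inv_closed inv_equality inv_inv m_closed)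

lemma med_majority:
  assumes "x \<in> X" "y \<in> X"
  shows "med A x y x = x" "med A x x y = x" "med A y x x = x"
proof -
  show "med A x y x = x" using assms median_absorb by blast
  moreover show "med A x x y = x" using assms median_absorb median_swap23 by metis
  ultimately show "med A y x x = x" using assms median_swap12 by metis
qed


section \<open>Reduced words in the groupoid of pairs of points\<close>

text \<open>
  The \<open>H\<close>-orbit of a pair is regarded as an arrow from the orbit of \<open>y\<close> to the orbit of \<open>z\<close>. These
  arrows form a groupoid, with \<open>arrow x y\<close> followed by \<open>arrow y z\<close> equal to \<open>arrow x z\<close>. Freeness
  makes the composition well defined: once a representative \<open>y\<close> of the source is chosen, the
  arrow has only one target \<open>z\<close>.
\<close>

definition arrow :: "'x \<Rightarrow> 'x \<Rightarrow> ('x \<times> 'x) set" where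
  "arrow y z = (\<lambda>h. (h \<cdot> y, h \<cdot> z)) ` H"

lemma arrow_shift:
  assumes "h \<in> H" "y \<in> X" "z \<in> X"
  shows "arrow (h \<cdot> y) (h \<cdot> z) = arrow y z"
proof -
  have "arrow (k \<cdot> a) (k \<cdot> b) \<subseteq> arrow a b" if "k \<in> H" "a \<in> X" "b \<in> X" for k a b
    using that by (auto simp: arrow_def simp flip: act_mult)
  from this[of h y z] this[of "inv\<^bsub>grp A\<^esub> h" "h \<cdot> y" "h \<cdot> z"] show ?thesis
    using assms by auto
qed

lemma arrow_eqD:
  assumes "arrow y z = arrow y' z'" "y' \<in> X" "z' \<in> X"
  shows "\<exists>h\<in>H. y' = h \<cdot> y \<and> z' = h \<cdot> z"
proof -
  have "(y', z') \<in> arrow y' z'"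
    using assms(2,3) unfolding arrow_def by (intro image_eqI[of _ _ "\<one>\<^bsub>grp A\<^esub>"]) auto
  then have "(y', z') \<in> arrow y z" using assms(1) by simp
  then show ?thesis by (auto simp: arrow_def)
qed

lemma arrow_same_source:
  "\<lbrakk>arrow y z = arrow y z'; y \<in> X; z \<in> X; z' \<in> X\<rbrakk> \<Longrightarrow> z = z'"
  using arrow_eqD[of y z y z'] act_free[of _ y] by force

definition starts :: "('x \<times> 'x) set list \<Rightarrow> 'x \<Rightarrow> bool" where
  "starts w y \<longleftrightarrow> w \<noteq> [] \<and> (\<exists>z\<in>X. hd w = arrow y z)"

lemma starts_Nil [simp]: "\<not> starts [] y"
  by (simp add: starts_def)

lemma starts_shift: "\<lbrakk>h \<in> H; y \<in> X\<rbrakk> \<Longrightarrow> starts w (h \<cdot> y) \<longleftrightarrow> starts w y"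
  unfolding starts_def by (metis act_closed act_inv(2) arrow_shift inv_closed)

lemma starts_arrow:
  "\<lbrakk>y \<in> X; z \<in> X; u \<in> X\<rbrakk> \<Longrightarrow> starts (arrow y z # w) u \<longleftrightarrow> (\<exists>h\<in>H. u = h \<cdot> y)"
  using arrow_shift arrow_eqD unfolding starts_def
  by simp (metis act_closed)

text \<open>
  No letter is an identity arrow and no two neighbouring letters can be composed: these are the
  normal forms for the universal group of the groupoid.
\<close>

inductive_set words :: "('x \<times> 'x) set list set" where
  Nil [simp]: "[] \<in> words"
| Cons: "\<lbrakk>y \<in> X; z \<in> X; y \<noteq> z; w \<in> words; \<not> starts w z\<rbrakk> \<Longrightarrow> arrow y z # w \<in> words"

text \<open>
  The words \<open>[]\<close> and \<open>[arrow y z]\<close> with \<open>z \<noteq> y\<close> form a copy of the median set through the empty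
  word, the point labelled \<open>y\<close> being the empty word itself. Every word \<open>w\<close> arises from exactly
  one point of this copy by continuing it away from the copy: \<open>gate y w\<close> is the label of that
  point, the projection of \<open>w\<close>, and \<open>rest y w\<close> the continuation. The function \<open>push\<close> reassembles
  them.
\<close>

definition gate :: "'x \<Rightarrow> ('x \<times> 'x) set list \<Rightarrow> 'x" where
  "gate y w = (if starts w y then THE z. z \<in> X \<and> hd w = arrow y z else y)"

definition rest :: "'x \<Rightarrow> ('x \<times> 'x) set list \<Rightarrow> ('x \<times> 'x) set list" where
  "rest y w = (if starts w y then tl w else w)"

definition push :: "'x \<Rightarrow> 'x \<Rightarrow> ('x \<times> 'x) set list \<Rightarrow> ('x \<times> 'x) set list" where
  "push y z w = (if y = z then w else arrow y z # w)"

lemma gate_arrow: "\<lbrakk>y \<in> X; z \<in> X\<rbrakk> \<Longrightarrow> gate y (arrow y z # w) = z"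
  unfolding gate_def by (auto simp: starts_def dest: arrow_same_source)

lemma rest_arrow: "\<lbrakk>y \<in> X; z \<in> X\<rbrakk> \<Longrightarrow> rest y (arrow y z # w) = w"
  by (auto simp: rest_def starts_def)

lemma gate_not_starts: "\<not> starts w y \<Longrightarrow> gate y w = y"
  by (simp add: gate_def)

lemma gate_Nil [simp]: "gate y [] = y"
  by (simp add: gate_def)

lemma rest_not_starts: "\<not> starts w y \<Longrightarrow> rest y w = w"
  by (simp add: rest_def)

lemma gate_rest_push:
  assumes "y \<in> X" "z \<in> X" "w \<in> words" "\<not> starts w z"
  shows "push y z w \<in> words" "gate y (push y z w) = z" "rest y (push y z w) = w"
  using assms by (auto simp: push_def gate_arrow rest_arrow gate_not_starts rest_not_starts words.Cons)

text \<open>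
  This and \<open>gate_rest_push\<close> say that words correspond bijectively to pairs of a label \<open>z\<close> and a
  word that does not start in the orbit of \<open>z\<close>, for each choice of \<open>y\<close>. The source orbit of the
  first letter may be represented by a point other than \<open>y\<close>, so the letter is rewritten first.
\<close>

lemma gate_rest:
  assumes w: "w \<in> words" and y: "y \<in> X"
  shows "gate y w \<in> X" "rest y w \<in> words" "\<not> starts (rest y w) (gate y w)"
    "push y (gate y w) (rest y w) = w"
proof -
  have "gate y w \<in> X \<and> rest y w \<in> words \<and> \<not> starts (rest y w) (gate y w)
      \<and> push y (gate y w) (rest y w) = w"
    using w
  proof cases
    case Nil
    then show ?thesis using y by (simp add: rest_def push_def)
  next
    case (Cons a b v)
    show ?thesis
    proof (cases "starts w y")
      case True
      then obtain h where h: "h \<in> H" "y = h \<cdot> a"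
        using Cons y starts_arrow by auto
      have w': "w = arrow y (h \<cdot> b) # v" using h Cons by (simp add: arrow_shift)
      have hb: "h \<cdot> b \<in> X" using h Cons by simp
      have "gate y w = h \<cdot> b" "rest y w = v"
        unfolding w' by (rule gate_arrow[OF y hb], rule rest_arrow[OF y hb])
      moreover have "y \<noteq> h \<cdot> b" using h Cons by (simp add: act_left_cancel)
      ultimately show ?thesis using h Cons y w'
        by (simp add: push_def starts_shift)
    next
      case False
      then show ?thesis using w y by (simp add: gate_not_starts rest_not_starts push_def)
    qed
  qed
  then show "gate y w \<in> X" "rest y w \<in> words" "\<not> starts (rest y w) (gate y w)"
    "push y (gate y w) (rest y w) = w" by auto
qed

lemma gate_shift:
  assumes "h \<in> H" "y \<in> X" "w \<in> words"
  shows "gate (h \<cdot> y) w = h \<cdot> gate y w"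
proof (cases "starts w y")
  case True
  then obtain z v where z: "z \<in> X" "w = arrow y z # v" 
    unfolding starts_def by (metis list.collapse)
  then have "w = arrow (h \<cdot> y) (h \<cdot> z) # v" using assms by (simp add: arrow_shift)
  moreover have "gate y w = z" using z assms by (simp add: gate_arrow)
  ultimately show ?thesis using z assms by (simp add: gate_arrow)
next
  case False
  then show ?thesis using assms by (simp add: starts_shift gate_not_starts)
qed

lemma rest_shift: "\<lbrakk>h \<in> H; y \<in> X\<rbrakk> \<Longrightarrow> rest (h \<cdot> y) w = rest y w"
  by (simp add: rest_def starts_shift)

lemma push_shift: "\<lbrakk>h \<in> H; y \<in> X; z \<in> X\<rbrakk> \<Longrightarrow> push (h \<cdot> y) (h \<cdot> z) w = push y z w"
  by (simp add: push_def arrow_shift act_left_cancel)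

text \<open>
  Left multiplication by \<open>arrow y z\<close>. Passing through the decomposition of words makes the
  groupoid law \<open>move_move\<close> immediate, without distinguishing whether letters merge, cancel or
  are merely put side by side.
\<close>

definition move :: "'x \<Rightarrow> 'x \<Rightarrow> ('x \<times> 'x) set list \<Rightarrow> ('x \<times> 'x) set list" where
  "move y z w = push y (gate z w) (rest z w)"

lemma move_closed [simp]: "\<lbrakk>y \<in> X; z \<in> X; w \<in> words\<rbrakk> \<Longrightarrow> move y z w \<in> words"
  by (simp add: move_def gate_rest_push gate_rest)

lemma gate_move [simp]: "\<lbrakk>y \<in> X; z \<in> X; w \<in> words\<rbrakk> \<Longrightarrow> gate y (move y z w) = gate z w"
  by (simp add: move_def gate_rest_push gate_rest)

lemma rest_move [simp]: "\<lbrakk>y \<in> X; z \<in> X; w \<in> words\<rbrakk> \<Longrightarrow> rest y (move y z w) = rest z w"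
  by (simp add: move_def gate_rest_push gate_rest)

lemma move_move [simp]:
  "\<lbrakk>x \<in> X; y \<in> X; z \<in> X; w \<in> words\<rbrakk> \<Longrightarrow> move x y (move y z w) = move x z w"
  unfolding move_def[of x] by simp

lemma move_same [simp]: "\<lbrakk>y \<in> X; w \<in> words\<rbrakk> \<Longrightarrow> move y y w = w"
  by (simp add: move_def gate_rest)

lemma move_shift:
  "\<lbrakk>h \<in> H; y \<in> X; z \<in> X; w \<in> words\<rbrakk> \<Longrightarrow> move (h \<cdot> y) (h \<cdot> z) w = move y z w"
  by (simp add: move_def gate_shift rest_shift push_shift gate_rest)

lemma move_not_starts: "\<not> starts w z \<Longrightarrow> move y z w = push y z w"
  by (simp add: move_def gate_not_starts rest_not_starts)

text \<open>
  The action of a letter does not depend on the chosen representatives, by \<open>move_shift\<close>.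
\<close>

definition letter_act :: "('x \<times> 'x) set \<Rightarrow> ('x \<times> 'x) set list \<Rightarrow> ('x \<times> 'x) set list" where
  "letter_act a = (SOME f. \<exists>y\<in>X. \<exists>z\<in>X. a = arrow y z \<and> f = move y z)"

lemma letter_act_arrow:
  assumes "y \<in> X" "z \<in> X" "w \<in> words"
  shows "letter_act (arrow y z) w = move y z w"
proof -
  have "\<exists>f. \<exists>u\<in>X. \<exists>v\<in>X. arrow y z = arrow u v \<and> f = move u v"
    using assms by blast
  from someI_ex[OF this] obtain u v where uv: "u \<in> X" "v \<in> X" "arrow u v = arrow y z" "letter_act (arrow y z) = move u v"
    unfolding letter_act_def by blast
  then obtain h where "h \<in> H" "y = h \<cdot> u" "z = h \<cdot> v" using arrow_eqD[of u v y z] assms by auto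
  then show ?thesis using uv assms by (simp add: move_shift)
qed

definition word_mult :: "('x \<times> 'x) set list \<Rightarrow> ('x \<times> 'x) set list \<Rightarrow> ('x \<times> 'x) set list"
    (infixl "\<star>" 70) where
  "w \<star> v = foldr letter_act w v"

lemma word_mult_Nil_left [simp]: "[] \<star> v = v"
  by (simp add: word_mult_def)

lemma word_mult_closed [simp]: "\<lbrakk>w \<in> words; v \<in> words\<rbrakk> \<Longrightarrow> w \<star> v \<in> words"
  by (induction rule: words.induct) (simp_all add: word_mult_def letter_act_arrow)

lemma word_mult_Cons [simp]:
  "\<lbrakk>y \<in> X; z \<in> X; w \<in> words; v \<in> words\<rbrakk> \<Longrightarrow> (arrow y z # w) \<star> v = move y z (w \<star> v)"
  using letter_act_arrow[of y z "w \<star> v"] word_mult_closed[of w v] by (simp add: word_mult_def)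

lemma push_word_mult:
  "\<lbrakk>y \<in> X; z \<in> X; w \<in> words; v \<in> words\<rbrakk> \<Longrightarrow> push y z w \<star> v = move y z (w \<star> v)"
  by (simp add: push_def)

lemma word_mult_Nil_right [simp]: "w \<in> words \<Longrightarrow> w \<star> [] = w"
  by (induction rule: words.induct) (simp_all add: move_not_starts push_def)

text \<open>
  The case of associativity in which the first factor is a single letter. With
  \<open>w = push z u r\<close> both sides are \<open>move y u (r \<star> v)\<close>, by the groupoid law.
\<close>

lemma move_word_mult:
  assumes "y \<in> X" "z \<in> X" "w \<in> words" "v \<in> words"
  shows "move y z w \<star> v = move y z (w \<star> v)"
proof -
  let ?u = "gate z w" and ?r = "rest z w"
  have "move y z w \<star> v = move y ?u (?r \<star> v)"
    using assms by (simp add: move_def push_word_mult gate_rest)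
  also have "\<dots> = move y z (move z ?u (?r \<star> v))"
    using assms by (simp add: gate_rest)
  also have "move z ?u (?r \<star> v) = push z ?u ?r \<star> v"
    using assms gate_rest by (intro push_word_mult[symmetric]) auto
  finally show ?thesis using assms by (simp add: gate_rest)
qed

lemma word_mult_assoc: "\<lbrakk>w \<in> words; v \<in> words; u \<in> words\<rbrakk> \<Longrightarrow> (w \<star> v) \<star> u = w \<star> (v \<star> u)"
  by (induction rule: words.induct) (simp_all add: move_word_mult)

text \<open>
  The group element of an arrow, an identity arrow giving the unit.
\<close>

definition step :: "'x \<Rightarrow> 'x \<Rightarrow> ('x \<times> 'x) set list" where
  "step y z = push y z []"

lemma step_closed [simp]: "\<lbrakk>y \<in> X; z \<in> X\<rbrakk> \<Longrightarrow> step y z \<in> words"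
  by (simp add: step_def gate_rest_push)

lemma step_word_mult [simp]: "\<lbrakk>y \<in> X; z \<in> X; w \<in> words\<rbrakk> \<Longrightarrow> step y z \<star> w = move y z w"
  by (simp add: step_def push_word_mult)

lemma move_step: "\<lbrakk>x \<in> X; y \<in> X; z \<in> X\<rbrakk> \<Longrightarrow> move x y (step y z) = step x z"
  by (simp add: step_def move_def gate_rest_push)

lemma step_shift: "\<lbrakk>h \<in> H; y \<in> X; z \<in> X\<rbrakk> \<Longrightarrow> step (h \<cdot> y) (h \<cdot> z) = step y z"
  by (simp add: step_def push_shift)

lemma gate_step: "\<lbrakk>y \<in> X; z \<in> X\<rbrakk> \<Longrightarrow> gate y (step y z) = z"
  by (simp add: step_def gate_rest_push)

lemma left_inverse_ex: "w \<in> words \<Longrightarrow> \<exists>v\<in>words. v \<star> w = []"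
proof (induction rule: words.induct)
  case (Cons y z w)
  then obtain v where "v \<in> words" "v \<star> w = []" by blast
  moreover have "arrow y z # w = move y z w"
    using Cons by (simp add: move_not_starts push_def)
  ultimately have "(v \<star> step z y) \<star> (arrow y z # w) = []"
    using Cons by (simp add: word_mult_assoc)
  then show ?case using Cons \<open>v \<in> words\<close> by (meson step_closed word_mult_closed)
qed auto

definition word_group :: "('x \<times> 'x) set list monoid" where
  "word_group = \<lparr>carrier = words, mult = (\<star>), one = []\<rparr>"

lemma word_group_simps [simp]:
  "carrier word_group = words" "mult word_group = (\<star>)" "one word_group = []"
  by (simp_all add: word_group_def)

lemma word_group: "group word_group"
  by (rule groupI) (auto simp: word_mult_assoc left_inverse_ex)

section \<open>The median of three words\<close>

text \<open>
  The translates of the copies through the empty word are all copies in the tree: \<open>gate y (g \<star> p)\<close>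
  is the projection of \<open>p\<close> to the copy that contains the inverse of \<open>g\<close>, for the orbit of \<open>y\<close>. A
  centre of three words is thus a word all of whose coordinates are medians.
\<close>

definition centre :: "('x \<times> 'x) set list \<Rightarrow> ('x \<times> 'x) set list \<Rightarrow> ('x \<times> 'x) set list
    \<Rightarrow> ('x \<times> 'x) set list \<Rightarrow> bool" where
  "centre p q r s \<longleftrightarrow> s \<in> words \<and> (\<forall>g\<in>words. \<forall>y\<in>X.
     gate y (g \<star> s) = med A (gate y (g \<star> p)) (gate y (g \<star> q)) (gate y (g \<star> r)))"

text \<open>
  After a translation one of the words is empty, and a word that projects like the empty word to
  every copy through the empty word has no first letter.
\<close>

lemma gates_determine:
  assumes p: "p \<in> words" and q: "q \<in> words"
    and eq: "\<And>g y. \<lbrakk>g \<in> words; y \<in> X\<rbrakk> \<Longrightarrow> gate y (g \<star> p) = gate y (g \<star> q)"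
  shows "p = q"
proof -
  obtain g where g: "g \<in> words" "g \<star> p = []" using left_inverse_ex p by blast
  have "g \<star> q \<in> words" using g q by simp
  then have "g \<star> q = []"
  proof cases
    case (Cons y z w)
    then have "gate y (g \<star> q) = z" by (simp add: gate_arrow)
    moreover have "gate y (g \<star> q) = y" using eq[of g y] g Cons by simp
    ultimately show ?thesis using Cons by simp
  qed
  then have "g \<star> p = g \<star> q" using g by simp
  then show ?thesis
    using left_inverse_ex[of g] g(1) p q by (metis word_mult_Nil_left word_mult_assoc)
qed

lemma centre_unique:
  "\<lbrakk>centre p q r s; centre p q r s'\<rbrakk> \<Longrightarrow> s = s'"
  unfolding centre_def by (rule gates_determine) auto

lemma centre_translate:
  assumes "p \<in> words" "q \<in> words" "r \<in> words" "k \<in> words" "centre p q r s"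
  shows "centre (k \<star> p) (k \<star> q) (k \<star> r) (k \<star> s)"
  using assms by (auto simp: centre_def simp flip: word_mult_assoc)

text \<open>
  Consider the copy whose coordinate is \<open>\<lambda>p. gate y (g \<star> p)\<close>. If it passes through the empty word,
  its coordinate is some \<open>gate z\<close>. Otherwise it lies beyond a point \<open>a \<noteq> b\<close> of one copy through the
  empty word, and then all words outside the branch at \<open>a\<close> enter it at the same point as
  the empty word does.
\<close>

lemma gate_word_mult_cases:
  assumes "g \<in> words" "y \<in> X"
  shows "(\<exists>z\<in>X. \<forall>p\<in>words. gate y (g \<star> p) = gate z p) \<or>
    (\<exists>a\<in>X. \<exists>b\<in>X. a \<noteq> b \<and> (\<forall>p\<in>words. gate b p \<noteq> a \<longrightarrow> gate y (g \<star> p) = gate y g))"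
  using assms
proof (induction arbitrary: y rule: words.induct)
  case (Cons a\<^sub>1 b\<^sub>1 g)
  note IH = Cons.IH
  show ?case
  proof (cases "\<exists>k\<in>H. y = k \<cdot> a\<^sub>1")
    case True
    then obtain k where k: "k \<in> H" "y = k \<cdot> a\<^sub>1" by blast
    have "gate y ((arrow a\<^sub>1 b\<^sub>1 # g) \<star> p) = gate (k \<cdot> b\<^sub>1) (g \<star> p)" if "p \<in> words" for p
      using that Cons k by (simp add: gate_shift)
    from this this[of "[]"] show ?thesis
      using IH[of "k \<cdot> b\<^sub>1"] k Cons.hyps by (simp add: words.Cons)
  next
    case False
    \<comment> \<open>no cancellation of the first letter: the product starts in the orbit of \<open>a\<^sub>1\<close>, not that of \<open>y\<close>\<close>
    have away: "gate y ((arrow a\<^sub>1 b\<^sub>1 # g) \<star> p) = y" if "gate b\<^sub>1 (g \<star> p) \<noteq> a\<^sub>1" "p \<in> words" for p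
      using that Cons False gate_rest(1)[of "g \<star> p" b\<^sub>1]
      by (auto simp: move_def push_def starts_arrow intro!: gate_not_starts)
    have away_Nil: "gate y (arrow a\<^sub>1 b\<^sub>1 # g) = y" "gate b\<^sub>1 g = b\<^sub>1"
      using Cons False by (auto simp: starts_arrow gate_not_starts)
    show ?thesis
      using IH[OF \<open>b\<^sub>1 \<in> X\<close>]
    proof (elim disjE bexE conjE)
      fix z assume z: "z \<in> X" "\<forall>p\<in>words. gate b\<^sub>1 (g \<star> p) = gate z p"
      then have "z = b\<^sub>1" using away_Nil(2) Cons by (metis words.Nil gate_Nil word_mult_Nil_right)
      then show ?thesis using z away away_Nil Cons.hyps by metis
    next
      fix a b assume "a \<in> X" "b \<in> X" "a \<noteq> b"
        "\<forall>p\<in>words. gate b p \<noteq> a \<longrightarrow> gate b\<^sub>1 (g \<star> p) = gate b\<^sub>1 g"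
      then show ?thesis using away away_Nil Cons.hyps by metis
    qed
  qed
qed auto

text \<open>
  It suffices to look at the copies through the candidate itself. For a copy lying beyond the
  point \<open>a\<close>, the local condition at the copy containing \<open>a\<close> prevents two of the three words from
  lying in the branch at \<open>a\<close>; the other two then have the same coordinate as the candidate, and so
  has the median.
\<close>

lemma centre_Nil_if_local:
  assumes pqr: "p \<in> words" "q \<in> words" "r \<in> words"
    and loc: "\<And>y. y \<in> X \<Longrightarrow> med A (gate y p) (gate y q) (gate y r) = y"
  shows "centre p q r []"
  unfolding centre_def
proof (intro conjI ballI)
  fix g y assume gy: "g \<in> words" "y \<in> X"
  show "gate y (g \<star> []) = med A (gate y (g \<star> p)) (gate y (g \<star> q)) (gate y (g \<star> r))"
    using gate_word_mult_cases[OF gy]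
  proof (elim disjE bexE conjE)
    fix z assume z: "z \<in> X" "\<forall>p\<in>words. gate y (g \<star> p) = gate z p"
    then have "gate y (g \<star> []) = z" by simp
    then show ?thesis using z pqr loc by simp
  next
    fix a b assume ab: "a \<in> X" "b \<in> X" "a \<noteq> b"
      "\<forall>p\<in>words. gate b p \<noteq> a \<longrightarrow> gate y (g \<star> p) = gate y g"
    have in_X: "gate b v \<in> X" "gate y (g \<star> v) \<in> X" if "v \<in> words" for v
      using that ab gy by (simp_all add: gate_rest)
    have "\<not> (gate b p = a \<and> gate b q = a)" "\<not> (gate b p = a \<and> gate b r = a)"
      "\<not> (gate b q = a \<and> gate b r = a)"
      using loc[of b] ab pqr in_X(1) by (auto simp: med_majority)
    then consider "gate b p \<noteq> a" "gate b q \<noteq> a" | "gate b p \<noteq> a" "gate b r \<noteq> a"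
      | "gate b q \<noteq> a" "gate b r \<noteq> a" by blast
    moreover have "gate y g \<in> X" using gy by (simp add: gate_rest)
    ultimately show ?thesis
      using ab(4) gy pqr in_X(2) by cases (simp_all add: med_majority)
  qed
qed simp

lemma length_move:
  assumes "y \<in> X" "z \<in> X" "w \<in> words"
  shows "length (move z y w) \<le> Suc (length w)"
    and "\<lbrakk>gate y w = z; y \<noteq> z\<rbrakk> \<Longrightarrow> length (move z y w) < length w"
proof -
  have "length w = length (push y (gate y w) (rest y w))" using assms gate_rest by simp
  then show "length (move z y w) \<le> Suc (length w)"
    and "\<lbrakk>gate y w = z; y \<noteq> z\<rbrakk> \<Longrightarrow> length (move z y w) < length w"
    by (auto simp: move_def push_def split: if_splits)
qed

text \<open>
  Start at the empty word. If the local condition fails at some copy, walk inside this copy to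
  the median \<open>z\<close> of the three projections. When two of the projections are equal to \<open>z\<close>, two words
  come closer by one letter while the third recedes by at most one, so the total length
  drops. When at most one of them is \<open>z\<close>, at least two of the words branch off elsewhere in this copy,
  so two of the three project to \<open>z\<close> itself in every other copy through \<open>z\<close>, and the local
  condition holds at \<open>z\<close>.
\<close>

lemma centre_ex:
  assumes "p \<in> words" "q \<in> words" "r \<in> words"
  shows "\<exists>s. centre p q r s"
  using assms
proof (induction "length p + length q + length r" arbitrary: p q r rule: less_induct)
  case less
  show ?case
  proof (cases "\<forall>y\<in>X. med A (gate y p) (gate y q) (gate y r) = y")
    case True
    then show ?thesis using centre_Nil_if_local less.prems by blast
  next
    case False
    then obtain y z where y: "y \<in> X" and z: "z = med A (gate y p) (gate y q) (gate y r)" "z \<noteq> y"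
      by blast
    have gX: "gate y p \<in> X" "gate y q \<in> X" "gate y r \<in> X"
      using less.prems y by (simp_all add: gate_rest)
    then have zX: "z \<in> X" using z median_closed by simp
    \<comment> \<open>translating by \<open>step z y\<close> turns the point labelled \<open>z\<close> into the empty word\<close>
    have "\<exists>s. centre (move z y p) (move z y q) (move z y r) s"
    proof (cases "gate y p = z \<and> gate y q = z \<or> gate y p = z \<and> gate y r = z
        \<or> gate y q = z \<and> gate y r = z")
      case True
      have "length (move z y p) + length (move z y q) + length (move z y r)
          < length p + length q + length r"
        using True length_move[OF y zX less.prems(1)] length_move[OF y zX less.prems(2)]
          length_move[OF y zX less.prems(3)] z(2) by auto
      then show ?thesis using less y zX by simp
    next
      case False
      have "med A (gate u (move z y p)) (gate u (move z y q)) (gate u (move z y r)) = u"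
        if u: "u \<in> X" for u
      proof (cases "\<exists>k\<in>H. u = k \<cdot> z")
        case True
        then obtain k where "k \<in> H" "u = k \<cdot> z" by blast
        then show ?thesis
          using less.prems y zX gX z(1) by (simp add: gate_shift flip: act_med)
      next
        case no: False
        have away: "gate u (move z y w) = u" if "w \<in> words" "gate y w \<noteq> z" for w
          using that no y zX u gate_rest(1)[of w y]
          by (auto simp: move_def push_def starts_arrow intro!: gate_not_starts)
        have uX: "gate u (move z y w) \<in> X" if "w \<in> words" for w
          using that u y zX by (simp add: gate_rest)
        consider "gate y p \<noteq> z" "gate y q \<noteq> z" | "gate y p \<noteq> z" "gate y r \<noteq> z"
          | "gate y q \<noteq> z" "gate y r \<noteq> z" using False by blast
        then show ?thesis
          using less.prems u uX by cases (simp_all add: away med_majority)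
      qed
      then show ?thesis
        using centre_Nil_if_local[of "move z y p" "move z y q" "move z y r"] less.prems y zX by auto
    qed
    then obtain s where "centre (move z y p) (move z y q) (move z y r) s" by blast
    from centre_translate[OF _ _ _ step_closed this, of y z]
    show ?thesis using less.prems y zX by auto
  qed
qed

definition word_med :: "('x \<times> 'x) set list \<Rightarrow> ('x \<times> 'x) set list \<Rightarrow> ('x \<times> 'x) set list
    \<Rightarrow> ('x \<times> 'x) set list" where
  "word_med p q r = (SOME s. centre p q r s)"

lemma centre_word_med: "\<lbrakk>p \<in> words; q \<in> words; r \<in> words\<rbrakk> \<Longrightarrow> centre p q r (word_med p q r)"
  unfolding word_med_def by (rule someI_ex) (rule centre_ex)

lemma word_med_eqI: "\<lbrakk>p \<in> words; q \<in> words; r \<in> words; centre p q r s\<rbrakk> \<Longrightarrow> word_med p q r = s"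
  using centre_word_med centre_unique by blast

lemma word_med_closed [simp]: "\<lbrakk>p \<in> words; q \<in> words; r \<in> words\<rbrakk> \<Longrightarrow> word_med p q r \<in> words"
  using centre_word_med by (simp add: centre_def)

lemma gate_word_med [simp]:
  "\<lbrakk>p \<in> words; q \<in> words; r \<in> words; g \<in> words; y \<in> X\<rbrakk> \<Longrightarrow> gate y (g \<star> word_med p q r)
    = med A (gate y (g \<star> p)) (gate y (g \<star> q)) (gate y (g \<star> r))"
  using centre_word_med by (simp add: centre_def)

lemma word_med_translate:
  "\<lbrakk>p \<in> words; q \<in> words; r \<in> words; k \<in> words\<rbrakk>
    \<Longrightarrow> k \<star> word_med p q r = word_med (k \<star> p) (k \<star> q) (k \<star> r)"
  by (metis centre_translate centre_word_med word_mult_closed word_med_eqI)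

lemma median_set_words: "median_set words word_med"
proof
  fix x y z u v assume in_words: "x \<in> words" "y \<in> words" "z \<in> words" "u \<in> words" "v \<in> words"
  have X: "gate a (g \<star> w) \<in> X" if "g \<in> words" "a \<in> X" "w \<in> words" for g a w
    using that by (simp add: gate_rest)
  show "word_med x y z = word_med y x z" 
    by (rule gates_determine) (use in_words X median_swap12 in auto)
  show "word_med x y z = word_med x z y"
    by (rule gates_determine) (use in_words X median_swap23 in auto)
  show "word_med (word_med x y z) u v = word_med (word_med x u v) (word_med y u v) z"
    by (rule gates_determine) (use in_words X median_distrib in auto)
  show "word_med x y x = x"
    by (rule gates_determine) (use in_words X median_absorb in auto)
qed simp

text \<open>
  The points of one copy are compared from their median \<open>c\<close>: every other copy through \<open>c\<close> sees all
  of them at \<open>c\<close>, so the local condition reduces to the definition of \<open>c\<close>.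
\<close>

lemma word_med_step:
  assumes "x\<^sub>0 \<in> X" "x \<in> X" "y \<in> X" "z \<in> X"
  shows "word_med (step x\<^sub>0 x) (step x\<^sub>0 y) (step x\<^sub>0 z) = step x\<^sub>0 (med A x y z)"
proof -
  define c where "c = med A x y z"
  have c: "c \<in> X" using assms median_closed by (simp add: c_def)
  have "med A (gate u (step c x)) (gate u (step c y)) (gate u (step c z)) = u" if u: "u \<in> X" for u
  proof (cases "\<exists>k\<in>H. u = k \<cdot> c")
    case True
    then obtain k where "k \<in> H" "u = k \<cdot> c" by blast
    then show ?thesis
      using assms c by (simp add: gate_shift gate_step flip: act_med c_def)
  next
    case False
    then have "gate u (step c w) = u" if "w \<in> X" for w
      using that c u by (auto simp: step_def push_def starts_arrow intro!: gate_not_starts)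
    then show ?thesis using assms u by (simp add: med_majority)
  qed
  then have "word_med (step c x) (step c y) (step c z) = []"
    using assms c by (intro word_med_eqI centre_Nil_if_local) auto
  with word_med_translate[of "step c x" "step c y" "step c z" "step x\<^sub>0 c"]
  show ?thesis using assms c by (simp add: move_step move_not_starts step_def[of x\<^sub>0 c] c_def)
qed

section \<open>The tree of copies as a free action\<close>

definition tree :: "(('x \<times> 'x) set list, ('x \<times> 'x) set list) fams" where
  "tree = \<lparr>grp = word_group, pts = words, med = word_med, act = (\<lambda>g. restrict ((\<star>) g) words)\<rparr>"

lemma fams_obj_tree: "fams_obj tree"
proof -
  have "group_action word_group words (\<lambda>g. restrict ((\<star>) g) words)"
    by (rule group_action_restrictI[OF word_group]) (auto simp: word_mult_assoc)
  moreover have "g = []" if "g \<in> words" "x \<in> words" "g \<star> x = x" for g x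
    using that group.r_cancel_one[OF word_group] by auto
  moreover have "words \<noteq> {}" using words.Nil by blast
  ultimately show ?thesis
    using median_set_words
    by (auto simp: fams_obj_def tree_def word_med_translate)
qed

text \<open>
  The element \<open>h\<close> goes to the loop \<open>arrow x\<^sub>0 (h \<cdot> x\<^sub>0)\<close>. Multiplicativity and equivariance are
  both the relation \<open>arrow x\<^sub>0 (h \<cdot> x\<^sub>0)\<close> times \<open>arrow x\<^sub>0 x\<close> equals \<open>arrow x\<^sub>0 (h \<cdot> x)\<close>, true because
  the second factor may be written \<open>arrow (h \<cdot> x\<^sub>0) (h \<cdot> x)\<close>.
\<close>

lemma tree_rt_embedding:
  assumes x0: "x\<^sub>0 \<in> X"
  shows "rt_embedding A tree (\<lambda>h. step x\<^sub>0 (h \<cdot> x\<^sub>0)) (step x\<^sub>0)"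
proof -
  have mult: "step x\<^sub>0 (h \<cdot> x\<^sub>0) \<star> step x\<^sub>0 x = step x\<^sub>0 (h \<cdot> x)" if "h \<in> H" "x \<in> X" for h x
    using that x0 step_shift[of h x\<^sub>0 x, symmetric] by (simp add: move_step)
  have inj: "inj_on (step x\<^sub>0) X"
    using x0 gate_step by (metis inj_onI)
  have "inj_on (\<lambda>h. step x\<^sub>0 (h \<cdot> x\<^sub>0)) H"
    using x0 inj act_right_cancel by (auto simp: inj_on_def)
  moreover have "(\<lambda>h. step x\<^sub>0 (h \<cdot> x\<^sub>0)) \<in> hom (grp A) word_group"
    using x0 by (auto simp: hom_def mult act_mult simp del: step_word_mult)
  moreover have "step x\<^sub>0 \<in> median_hom X (med A) words word_med"
    using x0 by (auto simp: median_hom_def word_med_step)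
  moreover have "step x\<^sub>0 ` X \<subseteq> orbit word_group (\<lambda>g. restrict ((\<star>) g) words) (step x\<^sub>0 x\<^sub>0)"
  proof (rule image_subsetI)
    fix x assume x: "x \<in> X"
    have "step x\<^sub>0 x = restrict ((\<star>) (step x\<^sub>0 x)) words (step x\<^sub>0 x\<^sub>0)"
      using x0 x by (simp add: step_def[of x\<^sub>0 x\<^sub>0] push_def del: step_word_mult)
    then show "step x\<^sub>0 x \<in> orbit word_group (\<lambda>g. restrict ((\<star>) g) words) (step x\<^sub>0 x\<^sub>0)"
      using step_closed[OF x0 x] unfolding orbit_def word_group_simps by blast
  qed
  ultimately show ?thesis
    using fams_obj_tree inj x0
    by (auto simp: rt_embedding_def fams_hom_def image_in_one_orbit_def tree_def mult
        simp del: step_word_mult)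
qed

end

section \<open>Terms and their codes\<close>

text \<open>
  The two sorts of terms. Points are built from a single constant, since all points of \<open>A\<close> lie
  in its orbit.
\<close>

datatype 'a gterm = Gen 'a | Mul "'a gterm" "'a gterm" | Inv "'a gterm"

datatype 'a pterm = Base | Act "'a gterm" "'a pterm" | Med "'a pterm" "'a pterm" "'a pterm"

text \<open>
  Every entry of the first list is announced by \<open>a\<close>, and \<open>b\<close> marks its end, so pairs of lists can be
  recovered from one list over any alphabet with at least two letters.
\<close>

definition pair_code :: "'a \<Rightarrow> 'a \<Rightarrow> 'a list \<Rightarrow> 'a list \<Rightarrow> 'a list" where
  "pair_code a b xs ys = concat (map (\<lambda>x. [a, x]) xs) @ b # ys"

lemma pair_code_inject:
  assumes "a \<noteq> b"
  shows "pair_code a b xs ys = pair_code a b xs' ys' \<longleftrightarrow> xs = xs' \<and> ys = ys'"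
proof (induction xs arbitrary: xs')
  case Nil
  then show ?case using assms by (cases xs') (auto simp: pair_code_def)
next
  case (Cons x xs)
  then show ?case using assms by (cases xs') (auto simp: pair_code_def)
qed

primrec gcode :: "'a \<Rightarrow> 'a \<Rightarrow> 'a gterm \<Rightarrow> 'a list" where
  "gcode a b (Gen x) = [a, x]"
| "gcode a b (Mul s t) = b # a # pair_code a b (gcode a b s) (gcode a b t)"
| "gcode a b (Inv s) = b # b # gcode a b s"

primrec pcode :: "'a \<Rightarrow> 'a \<Rightarrow> 'a pterm \<Rightarrow> 'a list" where
  "pcode a b Base = []"
| "pcode a b (Act s p) = a # pair_code a b (gcode a b s) (pcode a b p)"
| "pcode a b (Med p q r) = b # pair_code a b (pcode a b p) (pair_code a b (pcode a b q) (pcode a b r))"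

lemma inj_gcode:
  assumes "a \<noteq> b" shows "inj (gcode a b)"
proof (rule injI)
  show "gcode a b s = gcode a b t \<Longrightarrow> s = t" for s t
    by (induction s arbitrary: t; case_tac t) (use assms in \<open>auto simp: pair_code_inject\<close>)
qed

lemma inj_pcode:
  assumes "a \<noteq> b" shows "inj (pcode a b)"
proof (rule injI)
  show "pcode a b p = pcode a b q \<Longrightarrow> p = q" for p q
    by (induction p arbitrary: q; case_tac q)
      (use assms inj_gcode[OF assms] in \<open>auto simp: pair_code_inject inj_eq\<close>)
qed

context fams_object begin

section \<open>The term quotient\<close>

definition base :: 'x where "base = (SOME x. x \<in> X)"

lemma base_in [simp]: "base \<in> X"
  using pts_nonempty some_in_eq by (auto simp: base_def)

abbreviation elt :: "'h \<Rightarrow> ('h + 'x) gterm" where "elt h \<equiv> Gen (Inl h)"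
abbreviation transl :: "'x \<Rightarrow> ('h + 'x) gterm" where "transl x \<equiv> Gen (Inr x)"
abbreviation pt :: "'x \<Rightarrow> ('h + 'x) pterm" where "pt x \<equiv> Act (transl x) Base"
abbreviation unit_elt where "unit_elt \<equiv> elt \<one>\<^bsub>grp A\<^esub>"

text \<open>
  The congruence generated by the Horn clauses. The constant \<open>elt h\<close> names a group element
  of \<open>A\<close>, and \<open>transl x\<close> the element that carries the base point to \<open>x\<close>. Constants for
  values outside the carriers of \<open>A\<close> are identified with the unit, so that every term denotes
  something and no notion of well-formed term is needed.
\<close>

inductive geq :: "('h + 'x) gterm \<Rightarrow> ('h + 'x) gterm \<Rightarrow> bool" (infix "\<approx>" 50)
  and peq :: "('h + 'x) pterm \<Rightarrow> ('h + 'x) pterm \<Rightarrow> bool" (infix "\<doteq>" 50)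
where
  g_refl: "s \<approx> s"
| g_sym: "s \<approx> t \<Longrightarrow> t \<approx> s"
| g_trans: "\<lbrakk>s \<approx> t; t \<approx> u\<rbrakk> \<Longrightarrow> s \<approx> u"
| g_Mul: "\<lbrakk>s \<approx> s'; t \<approx> t'\<rbrakk> \<Longrightarrow> Mul s t \<approx> Mul s' t'"
| g_Inv: "s \<approx> s' \<Longrightarrow> Inv s \<approx> Inv s'"
| p_refl: "p \<doteq> p"
| p_sym: "p \<doteq> q \<Longrightarrow> q \<doteq> p"
| p_trans: "\<lbrakk>p \<doteq> q; q \<doteq> r\<rbrakk> \<Longrightarrow> p \<doteq> r"
| p_Act: "\<lbrakk>s \<approx> s'; p \<doteq> p'\<rbrakk> \<Longrightarrow> Act s p \<doteq> Act s' p'"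
| p_Med: "\<lbrakk>p \<doteq> p'; q \<doteq> q'; r \<doteq> r'\<rbrakk> \<Longrightarrow> Med p q r \<doteq> Med p' q' r'"
| assoc: "Mul (Mul s t) u \<approx> Mul s (Mul t u)"
| unit: "Mul unit_elt s \<approx> s"
| inverse: "Mul (Inv s) s \<approx> unit_elt"
| act_unit: "Act unit_elt p \<doteq> p"
| act_Mul: "Act (Mul s t) p \<doteq> Act s (Act t p)"
| act_Med: "Act s (Med p q r) \<doteq> Med (Act s p) (Act s q) (Act s r)"
| free: "Act s p \<doteq> p \<Longrightarrow> s \<approx> unit_elt"
| swap12: "Med p q r \<doteq> Med q p r"
| swap23: "Med p q r \<doteq> Med p r q"
| absorb: "Med p q p \<doteq> p"
| distrib: "Med (Med p q r) u v \<doteq> Med (Med p u v) (Med q u v) r"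
| elt_mult: "\<lbrakk>h \<in> H; k \<in> H\<rbrakk> \<Longrightarrow> elt (h \<otimes>\<^bsub>grp A\<^esub> k) \<approx> Mul (elt h) (elt k)"
| pt_base: "pt base \<doteq> Base"
| pt_act: "\<lbrakk>h \<in> H; x \<in> X\<rbrakk> \<Longrightarrow> pt (h \<cdot> x) \<doteq> Act (elt h) (pt x)"
| pt_med: "\<lbrakk>x \<in> X; y \<in> X; z \<in> X\<rbrakk> \<Longrightarrow> pt (med A x y z) \<doteq> Med (pt x) (pt y) (pt z)"
| elt_junk: "h \<notin> H \<Longrightarrow> elt h \<approx> unit_elt"
| transl_junk: "x \<notin> X \<Longrightarrow> transl x \<approx> unit_elt"

text \<open>
  A class is represented by the code of a chosen member, the tags being one letter from each
  summand of \<open>'h + 'x\<close>.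
\<close>

definition gcls :: "('h + 'x) gterm \<Rightarrow> ('h, 'x) univ" where
  "gcls s = gcode (Inl undefined) (Inr undefined) (SOME t. s \<approx> t)"

definition pcls :: "('h + 'x) pterm \<Rightarrow> ('h, 'x) univ" where
  "pcls p = pcode (Inl undefined) (Inr undefined) (SOME q. p \<doteq> q)"

lemma gcls_eq_iff: "gcls s = gcls t \<longleftrightarrow> s \<approx> t"
proof
  have rep: "u \<approx> (SOME t. u \<approx> t)" for u by (rule someI) (rule g_refl)
  assume "gcls s = gcls t"
  then have "(SOME u. s \<approx> u) = (SOME u. t \<approx> u)"
    unfolding gcls_def by (subst (asm) inj_eq[OF inj_gcode]) auto
  then show "s \<approx> t" using rep[of s] rep[of t] g_sym g_trans by metis
next
  assume "s \<approx> t"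
  then have "(\<approx>) s = (\<approx>) t" using g_sym g_trans by blast
  then show "gcls s = gcls t" by (simp add: gcls_def)
qed

lemma pcls_eq_iff: "pcls p = pcls q \<longleftrightarrow> p \<doteq> q"
proof
  have rep: "r \<doteq> (SOME q. r \<doteq> q)" for r by (rule someI) (rule p_refl)
  assume "pcls p = pcls q"
  then have "(SOME r. p \<doteq> r) = (SOME r. q \<doteq> r)"
    unfolding pcls_def by (subst (asm) inj_eq[OF inj_pcode]) auto
  then show "p \<doteq> q" using rep[of p] rep[of q] p_sym p_trans by metis
next
  assume "p \<doteq> q"
  then have "(\<doteq>) p = (\<doteq>) q" using p_sym p_trans by blast
  then show "pcls p = pcls q" by (simp add: pcls_def)
qed

lemma cls_in_range [simp]: "gcls s \<in> range gcls" "pcls p \<in> range pcls"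
  by (rule rangeI)+

definition gterm_of :: "('h, 'x) univ \<Rightarrow> ('h + 'x) gterm" where
  "gterm_of = inv_into UNIV gcls"

definition pterm_of :: "('h, 'x) univ \<Rightarrow> ('h + 'x) pterm" where
  "pterm_of = inv_into UNIV pcls"

lemma gterm_of_gcls: "gterm_of (gcls s) \<approx> s"
  by (simp add: gterm_of_def f_inv_into_f flip: gcls_eq_iff)

lemma pterm_of_pcls: "pterm_of (pcls p) \<doteq> p"
  by (simp add: pterm_of_def f_inv_into_f flip: pcls_eq_iff)

definition gmult :: "('h, 'x) univ \<Rightarrow> ('h, 'x) univ \<Rightarrow> ('h, 'x) univ" where
  "gmult a b = gcls (Mul (gterm_of a) (gterm_of b))"

definition pact :: "('h, 'x) univ \<Rightarrow> ('h, 'x) univ \<Rightarrow> ('h, 'x) univ" where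
  "pact a x = pcls (Act (gterm_of a) (pterm_of x))"

definition pmed :: "('h, 'x) univ \<Rightarrow> ('h, 'x) univ \<Rightarrow> ('h, 'x) univ \<Rightarrow> ('h, 'x) univ" where
  "pmed x y z = pcls (Med (pterm_of x) (pterm_of y) (pterm_of z))"

lemma cls_ops [simp]:
  "gmult (gcls s) (gcls t) = gcls (Mul s t)"
  "pact (gcls s) (pcls p) = pcls (Act s p)"
  "pmed (pcls p) (pcls q) (pcls r) = pcls (Med p q r)"
  by (simp_all add: gmult_def pact_def pmed_def gcls_eq_iff pcls_eq_iff
      g_Mul p_Act p_Med gterm_of_gcls pterm_of_pcls)

definition hull :: "('h, 'x) ufams" where
  "hull = \<lparr>grp = \<lparr>carrier = range gcls, mult = gmult, one = gcls unit_elt\<rparr>, pts = range pcls, med = pmed,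
    act = (\<lambda>a. restrict (pact a) (range pcls))\<rparr>"

lemma hull_simps [simp]:
  "carrier (grp hull) = range gcls" "mult (grp hull) = gmult" "one (grp hull) = gcls unit_elt"
  "pts hull = range pcls" "med hull = pmed"
  "act hull (gcls s) (pcls p) = pcls (Act s p)"
  by (simp_all add: hull_def)

lemma fams_obj_hull: "fams_obj hull"
proof -
  have "group (grp hull)"
  proof (rule groupI)
    fix a assume "a \<in> carrier (grp hull)"
    then obtain s where "a = gcls s" by auto
    then have "gcls (Inv s) \<otimes>\<^bsub>grp hull\<^esub> a = \<one>\<^bsub>grp hull\<^esub>"
      by (simp add: gcls_eq_iff inverse)
    then show "\<exists>b\<in>carrier (grp hull). b \<otimes>\<^bsub>grp hull\<^esub> a = \<one>\<^bsub>grp hull\<^esub>"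
      by (rule bexI) simp
  qed (auto simp: gcls_eq_iff intro: assoc unit)
  then have "group_action (grp hull) (range pcls) (\<lambda>a. restrict (pact a) (range pcls))"
    by (rule group_action_restrictI) (auto simp: pcls_eq_iff intro: act_unit act_Mul)
  then have action: "group_action (grp hull) (pts hull) (act hull)"
    by (simp add: hull_def)
  have "median_set (range pcls) pmed"
    by standard (auto simp: pcls_eq_iff intro: swap12 swap23 absorb distrib)
  with action show ?thesis
    by (auto simp: fams_obj_def pcls_eq_iff gcls_eq_iff intro: act_Med free)
qed

definition hull_grp :: "'h \<Rightarrow> ('h, 'x) univ" where "hull_grp h = gcls (elt h)"
definition hull_pt :: "'x \<Rightarrow> ('h, 'x) univ" where "hull_pt x = pcls (pt x)"

lemma hull_hom: "(hull_grp, hull_pt) \<in> fams_hom A hull"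
  by (auto simp: fams_hom_def median_hom_def hom_def hull_grp_def hull_pt_def
      gcls_eq_iff pcls_eq_iff intro: elt_mult pt_act pt_med)

lemma hull_one_orbit: "image_in_one_orbit A hull hull_pt"
  unfolding image_in_one_orbit_def
proof (rule bexI[OF _ base_in], clarify)
  fix x
  have "hull_pt base = pcls Base" by (simp add: hull_pt_def pcls_eq_iff pt_base)
  then have "hull_pt x = act hull (gcls (transl x)) (hull_pt base)"
    by (simp add: hull_pt_def)
  then show "hull_pt x \<in> orbit (grp hull) (act hull) (hull_pt base)"
    by (auto simp: orbit_def)
qed

end

section \<open>Evaluation of terms and the universal property\<close>

locale fams_extension = fams_object A + C: fams_object C
  for A :: "('h, 'x) fams" and C :: "('k, 'z) fams" +
  fixes \<psi>0 :: "'h \<Rightarrow> 'k" and \<psi> :: "'x \<Rightarrow> 'z"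
  assumes hom: "(\<psi>0, \<psi>) \<in> fams_hom A C" and one_orbit: "image_in_one_orbit A C \<psi>"
begin

lemmas homs = fams_homD[OF hom]

definition shift :: "'x \<Rightarrow> 'k" where
  "shift x = (SOME c. c \<in> C.H \<and> act C c (\<psi> base) = \<psi> x)"

lemma shift:
  assumes "x \<in> X"
  shows "shift x \<in> C.H" "act C (shift x) (\<psi> base) = \<psi> x"
proof -
  have "\<psi> x \<in> orbit (grp C) (act C) (\<psi> base)"
    using one_orbit image_in_one_orbit_iff_all[OF fams_obj C.fams_obj hom] base_in assms by blast
  then have "\<exists>c. c \<in> C.H \<and> act C c (\<psi> base) = \<psi> x" by (auto simp: orbit_def)
  from someI_ex[OF this]
  show "shift x \<in> C.H" "act C (shift x) (\<psi> base) = \<psi> x" by (simp_all add: shift_def)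
qed

primrec geval :: "('h + 'x) gterm \<Rightarrow> 'k" where
  "geval (Gen a) = (case a of Inl h \<Rightarrow> if h \<in> H then \<psi>0 h else \<one>\<^bsub>grp C\<^esub>
     | Inr x \<Rightarrow> if x \<in> X then shift x else \<one>\<^bsub>grp C\<^esub>)"
| "geval (Mul s t) = geval s \<otimes>\<^bsub>grp C\<^esub> geval t"
| "geval (Inv s) = inv\<^bsub>grp C\<^esub> geval s"

primrec peval :: "('h + 'x) pterm \<Rightarrow> 'z" where
  "peval Base = \<psi> base"
| "peval (Act s p) = act C (geval s) (peval p)"
| "peval (Med p q r) = med C (peval p) (peval q) (peval r)"

lemma geval_closed [simp]: "geval s \<in> C.H"
  by (induction s) (auto simp: homs shift split: sum.split)

lemma peval_closed [simp]: "peval p \<in> C.X"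
  by (induction p) (auto simp: homs C.median_closed)

lemma hom_one_eq [simp]: "\<psi>0 \<one>\<^bsub>grp A\<^esub> = \<one>\<^bsub>grp C\<^esub>"
  using homs(1) is_group C.is_group by (rule hom_one)

lemma peval_pt [simp]: "x \<in> X \<Longrightarrow> peval (pt x) = \<psi> x"
  by (simp add: shift)

text \<open>
  Each generating clause holds in \<open>C\<close>; the clause \<open>free\<close> is where freeness of the action on
  \<open>C\<close> enters.
\<close>

lemma eval_sound: "s \<approx> t \<Longrightarrow> geval s = geval t" "p \<doteq> q \<Longrightarrow> peval p = peval q"
proof (induction rule: geq_peq.inducts)
  case (free s p)
  then show ?case using C.act_free[of "geval s" "peval p"] by simp
next
  case (distrib p q r u v)
  show ?case unfolding peval.simps by (rule C.median_distrib) auto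
next
  case (swap12 p q r)
  show ?case unfolding peval.simps by (rule C.median_swap12) auto
next
  case (swap23 p q r)
  show ?case unfolding peval.simps by (rule C.median_swap23) auto
qed (simp_all add: C.act_mult C.act_med C.m_assoc C.median_absorb median_closed homs shift)

lemma geval_gterm_of [simp]: "geval (gterm_of (gcls s)) = geval s"
  by (rule eval_sound) (rule gterm_of_gcls)

lemma peval_pterm_of [simp]: "peval (pterm_of (pcls p)) = peval p"
  by (rule eval_sound) (rule pterm_of_pcls)

lemma eval_hom:
  "(restrict (geval \<circ> gterm_of) (carrier (grp hull)), restrict (peval \<circ> pterm_of) (pts hull))
    \<in> fams_hom hull C"
  by (auto simp: fams_hom_def median_hom_def hom_def)

text \<open>
  A morphism that is prescribed on \<open>A\<close> agrees with evaluation on all constants. For \<open>transl x\<close> this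
  uses freeness of the target: both candidates carry the image of the base point to the image
  of \<open>x\<close>. Induction over terms does the rest.
\<close>

lemma extension_unique:
  assumes \<phi>: "(\<phi>0, \<phi>) \<in> fams_hom hull C"
    and ext0: "\<And>h. h \<in> H \<Longrightarrow> \<phi>0 (hull_grp h) = \<psi>0 h"
    and ext: "\<And>x. x \<in> X \<Longrightarrow> \<phi> (hull_pt x) = \<psi> x"
  shows "\<phi>0 (gcls s) = geval s" "\<phi> (pcls p) = peval p"
proof -
  interpret hull: fams_object hull by standard (rule fams_obj_hull)
  note h = fams_homD[OF \<phi>]
  have one: "\<phi>0 (gcls unit_elt) = \<one>\<^bsub>grp C\<^esub>"
    using hom_one[OF h(1) hull.is_group C.is_group] by simp
  have Base: "\<phi> (pcls Base) = \<psi> base"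
    using ext[OF base_in] pt_base unfolding hull_pt_def by (simp flip: pcls_eq_iff)
  show g: "\<phi>0 (gcls s) = geval s" for s
  proof (induction s)
    case (Gen a)
    show ?case
    proof (cases a)
      case (Inl h)
      then show ?thesis using ext0[of h] one elt_junk[of h]
        by (auto simp: hull_grp_def simp flip: gcls_eq_iff)
    next
      case (Inr x)
      show ?thesis
      proof (cases "x \<in> X")
        case True
        \<comment> \<open>both elements carry \<open>\<psi> base\<close> to \<open>\<psi> x\<close>\<close>
        have "act C (\<phi>0 (gcls (transl x))) (\<psi> base) = \<phi> (hull_pt x)"
          using h(5)[of "gcls (transl x)" "pcls Base"] Base by (simp add: hull_pt_def)
        also have "\<dots> = act C (shift x) (\<psi> base)" using ext True by (simp add: shift)
        finally have "\<phi>0 (gcls (transl x)) = shift x"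
          using True by (intro C.act_right_cancel[of _ _ "\<psi> base"]) (auto simp: shift homs h)
        then show ?thesis using Inr True by simp
      next
        case False
        then show ?thesis using Inr one transl_junk[of x] by (auto simp flip: gcls_eq_iff)
      qed
    qed
  next
    case (Mul s t)
    then show ?case using h(6)[of "gcls s" "gcls t"] by simp
  next
    case (Inv s)
    have "\<phi>0 (gcls (Inv s)) \<otimes>\<^bsub>grp C\<^esub> geval s = \<phi>0 (gcls (Mul (Inv s) s))"
      using h(6)[of "gcls (Inv s)" "gcls s"] Inv by simp
    also have "gcls (Mul (Inv s) s) = gcls unit_elt" by (simp add: gcls_eq_iff inverse)
    finally show ?case using one h(3)[of "gcls (Inv s)"] by (simp add: C.inv_equality)
  qed
  show "\<phi> (pcls p) = peval p"
  proof (induction p)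
    case (Act s p)
    then show ?case using h(5)[of "gcls s" "pcls p"] g by simp
  next
    case (Med p q r)
    then show ?case using h(4)[of "pcls p" "pcls q" "pcls r"] by simp
  qed (simp add: Base)
qed

end

lemma (in fams_object) hull_rtup:
  assumes "fams_obj C"
  shows "rtup_at A hull hull_grp hull_pt C"
  unfolding rtup_at_def
proof (intro allI impI; elim conjE)
  fix \<psi>0 \<psi> assume "(\<psi>0, \<psi>) \<in> fams_hom A C" "image_in_one_orbit A C \<psi>"
  then interpret E: fams_extension A C \<psi>0 \<psi>
    using assms by unfold_locales
  let ?g = "restrict (E.geval \<circ> gterm_of) (carrier (grp hull))"
  let ?p = "restrict (E.peval \<circ> pterm_of) (pts hull)"
  show "\<exists>!(\<phi>0, \<phi>). (\<phi>0, \<phi>) \<in> fams_hom hull C \<and>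
      \<phi>0 \<in> extensional (carrier (grp hull)) \<and> \<phi> \<in> extensional (pts hull) \<and>
      (\<forall>h\<in>H. \<phi>0 (hull_grp h) = \<psi>0 h) \<and> (\<forall>x\<in>X. \<phi> (hull_pt x) = \<psi> x)"
  proof (rule ex1I[of _ "(?g, ?p)"], clarsimp simp only: prod.case)
    show "(?g, ?p) \<in> fams_hom hull C \<and>
      ?g \<in> extensional (carrier (grp hull)) \<and> ?p \<in> extensional (pts hull) \<and>
      (\<forall>h\<in>H. ?g (hull_grp h) = \<psi>0 h) \<and> (\<forall>x\<in>X. ?p (hull_pt x) = \<psi> x)"
      using E.eval_hom by (auto simp: hull_grp_def hull_pt_def E.shift)
  next
    fix \<phi> assume "case \<phi> of (\<phi>0, \<phi>) \<Rightarrow> (\<phi>0, \<phi>) \<in> fams_hom hull C \<and>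
      \<phi>0 \<in> extensional (carrier (grp hull)) \<and> \<phi> \<in> extensional (pts hull) \<and>
      (\<forall>h\<in>H. \<phi>0 (hull_grp h) = \<psi>0 h) \<and> (\<forall>x\<in>X. \<phi> (hull_pt x) = \<psi> x)"
    moreover obtain \<phi>0 \<phi>1 where \<phi>: "\<phi> = (\<phi>0, \<phi>1)" by fastforce
    ultimately have *: "(\<phi>0, \<phi>1) \<in> fams_hom hull C" "\<phi>0 \<in> extensional (carrier (grp hull))"
      "\<phi>1 \<in> extensional (pts hull)" "\<And>h. h \<in> H \<Longrightarrow> \<phi>0 (hull_grp h) = \<psi>0 h"
      "\<And>x. x \<in> X \<Longrightarrow> \<phi>1 (hull_pt x) = \<psi> x" by auto
    note uniq = E.extension_unique[OF *(1,4,5)]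
    have "\<phi>0 = ?g"
      by (rule extensionalityI[OF *(2)]) (auto simp: uniq)
    moreover have "\<phi>1 = ?p"
      by (rule extensionalityI[OF *(3)]) (auto simp: uniq)
    ultimately show "\<phi> = (?g, ?p)" using \<phi> by simp
  qed
qed

text \<open>
  Evaluation in the tree separates the points of \<open>A\<close>, so their classes are distinct.
  Injectivity on the group follows since the action on \<open>A\<close> is free.
\<close>

lemma (in fams_object) hull_rt_embedding: "rt_embedding A hull hull_grp hull_pt"
proof -
  interpret hull: fams_object hull by standard (rule fams_obj_hull)
  note emb = tree_rt_embedding[OF base_in]
  interpret E: fams_extension A tree "\<lambda>h. step base (h \<cdot> base)" "step base"
    using emb fams_obj_tree by unfold_locales (simp_all add: rt_embedding_def)
  have "x = y" if "x \<in> X" "y \<in> X" "hull_pt x = hull_pt y" for x y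
  proof -
    have "E.peval (pt x) = E.peval (pt y)"
      using that(3) by (intro E.eval_sound) (simp add: hull_pt_def pcls_eq_iff)
    then have "step base x = step base y" using that by (simp only: E.peval_pt)
    then show "x = y" using emb that by (auto simp: rt_embedding_def dest: inj_onD)
  qed
  then have inj: "inj_on hull_pt X" by (rule inj_onI)
  moreover have "inj_on hull_grp H"
  proof (rule inj_onI)
    fix h k assume hk: "h \<in> H" "k \<in> H" "hull_grp h = hull_grp k"
    then have "hull_pt (h \<cdot> base) = hull_pt (k \<cdot> base)"
      using fams_homD(5)[OF hull_hom] by simp
    then have "h \<cdot> base = k \<cdot> base" using inj hk by (simp add: inj_on_eq_iff)
    then show "h = k" using hk act_right_cancel base_in by blast
  qed
  ultimately show ?thesis
    using fams_obj_hull hull_hom hull_one_orbit by (simp add: rt_embedding_def)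
qed

section \<open>Transfer of the universal property between universal objects\<close>

lemma fams_hom_comp:
  assumes "(f0, f) \<in> fams_hom A B" "(g0, g) \<in> fams_hom B C"
  shows "(g0 \<circ> f0, g \<circ> f) \<in> fams_hom A C"
  using assms by (auto simp: fams_hom_def median_hom_def hom_def Pi_iff)

lemma fams_hom_cong:
  assumes "fams_obj A" "(f0, f) \<in> fams_hom A B"
    and "\<And>g. g \<in> carrier (grp A) \<Longrightarrow> f0' g = f0 g" "\<And>x. x \<in> pts A \<Longrightarrow> f' x = f x"
  shows "(f0', f') \<in> fams_hom A B"
proof -
  interpret fams_object A by standard fact
  show ?thesis using assms by (auto simp: fams_hom_def median_hom_def hom_def Pi_iff median_closed)
qed

lemma one_orbit_comp:
  assumes "image_in_one_orbit A B f" "(f0, f) \<in> fams_hom A B" "(g0, g) \<in> fams_hom B C"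
  shows "image_in_one_orbit A C (g \<circ> f)"
proof -
  from assms(1) obtain x where x: "x \<in> pts A" "f ` pts A \<subseteq> orbit (grp B) (act B) (f x)"
    by (auto simp: image_in_one_orbit_def)
  note f = fams_homD[OF assms(2)] and g = fams_homD[OF assms(3)]
  have "(g \<circ> f) ` pts A \<subseteq> orbit (grp C) (act C) ((g \<circ> f) x)"
  proof clarify
    fix y assume "y \<in> pts A"
    then obtain k where "k \<in> carrier (grp B)" "f y = act B k (f x)"
      using x by (auto simp: orbit_def)
    then show "(g \<circ> f) y \<in> orbit (grp C) (act C) ((g \<circ> f) x)"
      using x f(2) g(3,5) by (auto simp: orbit_def)
  qed
  then show ?thesis using x by (auto simp: image_in_one_orbit_def)
qed

lemma rtup_at_ex:
  assumes "rtup_at A B i0 i C" "(\<psi>0, \<psi>) \<in> fams_hom A C" "image_in_one_orbit A C \<psi>"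
  obtains \<phi>0 \<phi> where "(\<phi>0, \<phi>) \<in> fams_hom B C"
    "\<And>h. h \<in> carrier (grp A) \<Longrightarrow> \<phi>0 (i0 h) = \<psi>0 h" "\<And>x. x \<in> pts A \<Longrightarrow> \<phi> (i x) = \<psi> x"
  using assms unfolding rtup_at_def by (blast dest: ex1_implies_ex)

text \<open>
  The uniqueness half of the universal property, for morphisms that need not be extensional. It
  applies to the common restriction \<open>f \<circ> i\<close> of the two morphisms, which has image in one orbit
  because \<open>i\<close> does.
\<close>

lemma rtup_at_unique:
  assumes rt: "rtup_at A B i0 i C" and emb: "rt_embedding A B i0 i"
    and f: "(f0, f) \<in> fams_hom B C" and g: "(g0, g) \<in> fams_hom B C"
    and eq0: "\<And>h. h \<in> carrier (grp A) \<Longrightarrow> f0 (i0 h) = g0 (i0 h)"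
    and eq: "\<And>x. x \<in> pts A \<Longrightarrow> f (i x) = g (i x)"
  shows "\<And>b. b \<in> carrier (grp B) \<Longrightarrow> f0 b = g0 b" "\<And>y. y \<in> pts B \<Longrightarrow> f y = g y"
proof -
  have i: "(i0, i) \<in> fams_hom A B" "image_in_one_orbit A B i" "fams_obj B"
    using emb by (simp_all add: rt_embedding_def)
  note ii = fams_homD[OF i(1)]
  define P where "P = (\<lambda>(\<phi>0, \<phi>). (\<phi>0, \<phi>) \<in> fams_hom B C \<and>
    \<phi>0 \<in> extensional (carrier (grp B)) \<and> \<phi> \<in> extensional (pts B) \<and>
    (\<forall>h\<in>carrier (grp A). \<phi>0 (i0 h) = (f0 \<circ> i0) h) \<and> (\<forall>x\<in>pts A. \<phi> (i x) = (f \<circ> i) x))"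
  have "\<exists>!\<phi>. P \<phi>"
    unfolding P_def
    using rt fams_hom_comp[OF i(1) f] one_orbit_comp[OF i(2,1) f] unfolding rtup_at_def by blast
  moreover have "P (restrict f0 (carrier (grp B)), restrict f (pts B))"
    "P (restrict g0 (carrier (grp B)), restrict g (pts B))"
    using ii eq eq0 fams_hom_cong[OF i(3) f] fams_hom_cong[OF i(3) g]
    by (auto simp: P_def)
  ultimately have "restrict f0 (carrier (grp B)) = restrict g0 (carrier (grp B))"
    "restrict f (pts B) = restrict g (pts B)" by blast+
  then show "\<And>b. b \<in> carrier (grp B) \<Longrightarrow> f0 b = g0 b" "\<And>y. y \<in> pts B \<Longrightarrow> f y = g y"
    by (metis restrict_apply')+
qed

text \<open>
  The universal properties of \<open>B\<close> and \<open>D\<close> give morphisms \<open>f\<close> and \<open>g\<close> between them under \<open>A\<close>, with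
  \<open>g \<circ> f\<close> the identity of \<open>B\<close>. Morphisms from \<open>D\<close> to \<open>C\<close> are pulled back along \<open>f\<close>; two morphisms
  from \<open>B\<close> to \<open>C\<close> that agree on \<open>A\<close> agree after composition with \<open>g\<close>, hence after composition
  with \<open>g \<circ> f\<close>.
\<close>

lemma rtup_at_transfer:
  assumes embB: "rt_embedding A B i0 i" and embD: "rt_embedding A D j0 j"
    and BB: "rtup_at A B i0 i B" and BD: "rtup_at A B i0 i D" and DB: "rtup_at A D j0 j B"
    and DC: "rtup_at A D j0 j C"
  shows "rtup_at A B i0 i C"
proof -
  have i: "(i0, i) \<in> fams_hom A B" "image_in_one_orbit A B i" "fams_obj B"
    and j: "(j0, j) \<in> fams_hom A D" "image_in_one_orbit A D j"
    using embB embD by (simp_all add: rt_embedding_def)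
  note ii = fams_homD[OF i(1)]
  obtain f0 f where f: "(f0, f) \<in> fams_hom B D" "\<And>h. h \<in> carrier (grp A) \<Longrightarrow> f0 (i0 h) = j0 h"
    "\<And>x. x \<in> pts A \<Longrightarrow> f (i x) = j x" using rtup_at_ex[OF BD j] by metis
  obtain g0 g where g: "(g0, g) \<in> fams_hom D B" "\<And>h. h \<in> carrier (grp A) \<Longrightarrow> g0 (j0 h) = i0 h"
    "\<And>x. x \<in> pts A \<Longrightarrow> g (j x) = i x" using rtup_at_ex[OF DB i(1,2)] by metis
  have id: "(id, id) \<in> fams_hom B B" by (auto simp: fams_hom_def median_hom_def hom_def)
  have gf: "\<And>b. b \<in> carrier (grp B) \<Longrightarrow> (g0 \<circ> f0) b = id b" "\<And>y. y \<in> pts B \<Longrightarrow> (g \<circ> f) y = id y"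
    using rtup_at_unique[OF BB embB fams_hom_comp[OF f(1) g(1)] id] f g by auto
  show ?thesis
    unfolding rtup_at_def
  proof (intro allI impI; elim conjE)
    fix \<psi>0 \<psi> assume \<psi>: "(\<psi>0, \<psi>) \<in> fams_hom A C" "image_in_one_orbit A C \<psi>"
    obtain \<phi>0 \<phi> where \<phi>: "(\<phi>0, \<phi>) \<in> fams_hom D C"
      "\<And>h. h \<in> carrier (grp A) \<Longrightarrow> \<phi>0 (j0 h) = \<psi>0 h" "\<And>x. x \<in> pts A \<Longrightarrow> \<phi> (j x) = \<psi> x"
      using rtup_at_ex[OF DC \<psi>] by metis
    define P where "P = (\<lambda>(\<phi>0, \<phi>). (\<phi>0, \<phi>) \<in> fams_hom B C \<and>
      \<phi>0 \<in> extensional (carrier (grp B)) \<and> \<phi> \<in> extensional (pts B) \<and>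
      (\<forall>h\<in>carrier (grp A). \<phi>0 (i0 h) = \<psi>0 h) \<and> (\<forall>x\<in>pts A. \<phi> (i x) = \<psi> x))"
    have "P (restrict (\<phi>0 \<circ> f0) (carrier (grp B)), restrict (\<phi> \<circ> f) (pts B))"
      using fams_hom_cong[OF i(3) fams_hom_comp[OF f(1) \<phi>(1)]] ii f \<phi> by (auto simp: P_def)
    moreover have "\<chi> = \<chi>'" if P: "P \<chi>" "P \<chi>'" for \<chi> \<chi>'
    proof -
      obtain a0 a b0 b where ab: "\<chi> = (a0, a)" "\<chi>' = (b0, b)" by fastforce
      have a: "(a0, a) \<in> fams_hom B C" and b: "(b0, b) \<in> fams_hom B C"
        using P ab by (auto simp: P_def)
      have ag: "(a0 \<circ> g0, a \<circ> g) \<in> fams_hom D C" and bg: "(b0 \<circ> g0, b \<circ> g) \<in> fams_hom D C"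
        using fams_hom_comp[OF g(1)] a b by auto
      have on_A0: "(a0 \<circ> g0) (j0 h) = (b0 \<circ> g0) (j0 h)" if "h \<in> carrier (grp A)" for h
        using P ab that g(2) by (auto simp: P_def)
      have on_A: "(a \<circ> g) (j x) = (b \<circ> g) (j x)" if "x \<in> pts A" for x
        using P ab that g(3) by (auto simp: P_def)
      note on_D = rtup_at_unique[OF DC embD ag bg on_A0 on_A]
      have "a0 x = b0 x" if "x \<in> carrier (grp B)" for x
        using on_D(1)[of "f0 x"] fams_homD(3)[OF f(1) that] gf(1)[OF that] by simp
      moreover have "a y = b y" if "y \<in> pts B" for y
        using on_D(2)[of "f y"] fams_homD(2)[OF f(1) that] gf(2)[OF that] by simp
      moreover have "a0 \<in> extensional (carrier (grp B))" "b0 \<in> extensional (carrier (grp B))"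
        "a \<in> extensional (pts B)" "b \<in> extensional (pts B)"
        using P ab by (auto simp: P_def)
      ultimately have "a0 = b0" "a = b" by (blast intro: extensionalityI)+
      then show ?thesis using ab by simp
    qed
    ultimately have "\<exists>!\<chi>. P \<chi>" by blast
    then show "\<exists>!(\<phi>0, \<phi>). (\<phi>0, \<phi>) \<in> fams_hom B C \<and>
        \<phi>0 \<in> extensional (carrier (grp B)) \<and> \<phi> \<in> extensional (pts B) \<and>
        (\<forall>h\<in>carrier (grp A). \<phi>0 (i0 h) = \<psi>0 h) \<and> (\<forall>x\<in>pts A. \<phi> (i x) = \<psi> x)"
      unfolding P_def .
  qed
qed

theorem theorem2:
  fixes A :: "('h, 'x) fams"
  assumes "fams_obj A"
  shows "(\<exists>B \<iota>0 \<iota>. rt_universal A B \<iota>0 \<iota>) \<and>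
         (\<forall>B \<iota>0 \<iota>. rt_universal A B \<iota>0 \<iota> \<longrightarrow>
            (\<forall>C :: ('k, 'z) fams. fams_obj C \<longrightarrow> rtup_at A B \<iota>0 \<iota> C))"
proof -
  interpret fams_object A by standard fact
  show ?thesis
  proof (intro conjI allI impI)
    show "\<exists>B \<iota>0 \<iota>. rt_universal A B \<iota>0 \<iota>"
      unfolding rt_universal_def using hull_rt_embedding hull_rtup by blast
  next
    fix B :: "('h, 'x) ufams" and \<iota>0 \<iota> and C :: "('k, 'z) fams"
    assume "rt_universal A B \<iota>0 \<iota>" "fams_obj C"
    then show "rtup_at A B \<iota>0 \<iota> C"
      using hull_rt_embedding hull_rtup fams_obj_hull
      unfolding rt_universal_def
      by (metis rt_embedding_def rtup_at_transfer)
  qed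
qed

end
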